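(* For every $\mu \in \mathcal{M}$ and every de Branges space $\mathcal{H}$ that is isometrically isomorphic to $\ell^2(\mu)$, there exists a Hilbert space of entire functions $\widetilde{\mathcal{H}}$ such that: (1) $\widetilde{\mathcal{H}}$ is isometrically isomorphic to $\ell^2(\mu)$; (2) $\widetilde{\mathcal{H}}$ satisfies (H1) and (H3), but does not satisfy (H2); (3) $\mathcal{H} \cap \widetilde{\mathcal{H}}$ is dense in $\mathcal{H}$ (with respect to the norm of $\mathcal{H}$) and dense in $\widetilde{\mathcal{H}}$ (with respect to the norm of $\widetilde{\mathcal{H}}$). Here the class $\mathcal{M}$, the properties (H1), (H2), (H3), de Branges spaces, and the phrase "isometrically isomorphic to $\ell^2(\mu)$" are as defined in the context.
   Context: A Hilbert space of entire functions is a complex vector space of entire functions $\mathbb{C} \to \mathbb{C}$ (with pointwise operations) equipped with an inner product making it a Hilbert space. For an entire function $F$ put $F^*(z) = \overline{F(\bar z)}$. Consider the following properties of a Hilbert space of entire functions: (H1) Whenever $F$ is in the space and has a non-real zero $w$, the function $z \mapsto F(z)(z - \bar w)(z - w)^{-1}$ (extended analytically to $z = w$) belongs to the space and has the same norm as $F$. (H2) For every complex number $w$, the linear functional defined on the space by $F \mapsto F(w)$ is continuous. (H3) Whenever $F$ is in the space, the function $F^*$ belongs to the space and has the same norm as $F$. A de Branges space is a Hilbert space of entire functions, different from $\{0\}$, that satisfies (H1), (H2) and (H3). $\mathcal{M}$ is the set of all Borel measures $\mu$ supported on infinite discrete (i.e. having no finite accumulation points) subsets of the real line. For $\mu \in \mathcal{M}$,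 $\{t_i\}_{i \in \mathbb{N}}$ denotes an enumeration of $\operatorname{supp}\mu$ (without repetitions) and $\mu_n = \mu(\{t_n\})$ the mass of $\mu$ at $t_n$, with $0 < \mu_n < \infty$. $\ell^2(\mu)$ is the Hilbert space of complex sequences $v = \{v_i\}_{i \in \mathbb{N}}$ with $\|v\|^2_{\ell^2(\mu)} = \sum_n \mu_n |v_n|^2 < +\infty$. A Hilbert space of entire functions $\mathcal{H}$ is called isometrically isomorphic to $\ell^2(\mu)$, where $\mu \in \mathcal{M}$, if $\|F\|^2_{\mathcal{H}} = \sum_n \mu_n |F(t_n)|^2$ for all $F \in \mathcal{H}$ and the map $F \mapsto \{F(t_i)\}_{i \in \mathbb{N}}$ is a bijection of $\mathcal{H}$ onto $\ell^2(\mu)$. *)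

theory Defs
  imports "HOL-Analysis.Analysis" "HOL-Complex_Analysis.Complex_Analysis"
begin

section \<open>Hilbert spaces of entire functions\<close>

text \<open>
  A space is given by its carrier \<open>H\<close> and its inner product \<open>ip\<close>, linear in the first
  argument. The values of \<open>ip\<close> outside \<open>H\<close> are irrelevant; since the library locale
  \<^locale>\<open>Metric_space\<close> requires a distance that is symmetric and nonnegative on the whole type,
  \<open>ip_dist\<close> is set to \<open>0\<close> there.
\<close>

type_synonym inner_product = "(complex \<Rightarrow> complex) \<Rightarrow> (complex \<Rightarrow> complex) \<Rightarrow> complex"

definition ip_norm :: "inner_product \<Rightarrow> (complex \<Rightarrow> complex) \<Rightarrow> real" where
  "ip_norm ip F = sqrt (Re (ip F F))"

definition ip_dist ::
  "(complex \<Rightarrow> complex) set \<Rightarrow> inner_product \<Rightarrow> (complex \<Rightarrow> complex) \<Rightarrow> (complex \<Rightarrow> complex) \<Rightarrow> real" where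
  "ip_dist H ip F G = (if F \<in> H \<and> G \<in> H then ip_norm ip (\<lambda>z. F z - G z) else 0)"

abbreviation ip_topology ::
  "(complex \<Rightarrow> complex) set \<Rightarrow> inner_product \<Rightarrow> (complex \<Rightarrow> complex) topology" where
  "ip_topology H ip \<equiv> Metric_space.mtopology H (ip_dist H ip)"

locale entire_inner_product_space =
  fixes H :: "(complex \<Rightarrow> complex) set" and ip :: inner_product
  assumes entire: "F \<in> H \<Longrightarrow> F holomorphic_on UNIV"
    and zero_mem: "(\<lambda>_. 0) \<in> H"
    and add_mem: "\<lbrakk>F \<in> H; G \<in> H\<rbrakk> \<Longrightarrow> (\<lambda>z. F z + G z) \<in> H"
    and scale_mem: "F \<in> H \<Longrightarrow> (\<lambda>z. c * F z) \<in> H"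
    and ip_add: "\<lbrakk>F \<in> H; G \<in> H; K \<in> H\<rbrakk> \<Longrightarrow> ip (\<lambda>z. F z + G z) K = ip F K + ip G K"
    and ip_scale: "\<lbrakk>F \<in> H; G \<in> H\<rbrakk> \<Longrightarrow> ip (\<lambda>z. c * F z) G = c * ip F G"
    and ip_cnj: "\<lbrakk>F \<in> H; G \<in> H\<rbrakk> \<Longrightarrow> ip G F = cnj (ip F G)"
    and ip_pos: "\<lbrakk>F \<in> H; F \<noteq> (\<lambda>_. 0)\<rbrakk> \<Longrightarrow> Re (ip F F) > 0"
begin

lemma diff_mem: "\<lbrakk>F \<in> H; G \<in> H\<rbrakk> \<Longrightarrow> (\<lambda>z. F z - G z) \<in> H"
  using add_mem[of F "\<lambda>z. - 1 * G z"] scale_mem[of G "- 1"] by simp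

lemma ip_zero [simp]: "F \<in> H \<Longrightarrow> ip (\<lambda>_. 0) F = 0"
  using ip_scale[of "\<lambda>_. 0" F 0] zero_mem by simp

lemma ip_self_nonneg: "F \<in> H \<Longrightarrow> 0 \<le> Re (ip F F)"
  using ip_pos[of F] ip_zero[of F] by (cases "F = (\<lambda>_. 0)") auto

lemma Re_ip_expand:
  assumes "F \<in> H" "G \<in> H"
  shows "Re (ip (\<lambda>z. F z + complex_of_real s * G z) (\<lambda>z. F z + complex_of_real s * G z)) =
    Re (ip F F) + 2 * s * Re (ip F G) + s\<^sup>2 * Re (ip G G)"
proof -
  let ?G = "\<lambda>z. complex_of_real s * G z" and ?K = "\<lambda>z. F z + complex_of_real s * G z"
  have mem: "?G \<in> H" "?K \<in> H"
    using assms add_mem scale_mem by auto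
  have right: "Re (ip L ?K) = Re (ip L F) + s * Re (ip L G)" if L: "L \<in> H" for L
  proof -
    have "ip L ?K = cnj (ip ?K L)" using ip_cnj mem L by blast
    also have "ip ?K L = ip F L + complex_of_real s * ip G L"
      using ip_add[of F ?G L] ip_scale[of G L] assms mem L by simp
    finally show ?thesis using ip_cnj[of F L] ip_cnj[of G L] assms L by simp
  qed
  have "ip ?K ?K = ip F ?K + complex_of_real s * ip G ?K"
    using ip_add[of F ?G ?K] ip_scale[of G ?K] assms mem by simp
  moreover have "Re (ip G F) = Re (ip F G)" using ip_cnj[of F G] assms by simp
  ultimately show ?thesis
    using right[OF assms(1)] right[OF assms(2)] by (simp add: algebra_simps power2_eq_square)
qed

lemma Re_ip_le:
  assumes "F \<in> H" "G \<in> H"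
  shows "Re (ip F G) \<le> ip_norm ip F * ip_norm ip G"
proof (cases "G = (\<lambda>_. 0)")
  case True
  have "ip F (\<lambda>_. 0) = 0" using ip_cnj[OF zero_mem assms(1)] assms(1) by simp
  then show ?thesis using True assms ip_self_nonneg zero_mem by (simp add: ip_norm_def)
next
  case False
  define a b c where "a = Re (ip F F)" and "b = Re (ip F G)" and "c = Re (ip G G)"
  have c: "c > 0" using ip_pos assms False by (simp add: c_def)
  have "0 \<le> a + 2 * s * b + s\<^sup>2 * c" for s
    using Re_ip_expand[OF assms, of s]
      ip_self_nonneg[OF add_mem[OF assms(1) scale_mem[OF assms(2), of "complex_of_real s"]]]
    by (simp add: a_def b_def c_def)
  from this[of "- b / c"] have "b\<^sup>2 \<le> a * c"
    using c by (simp add: field_simps power2_eq_square)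
  then have "b \<le> sqrt (a * c)" by (simp add: real_le_rsqrt)
  then show ?thesis by (simp add: a_def b_def c_def ip_norm_def real_sqrt_mult)
qed

lemma ip_norm_triangle:
  assumes "F \<in> H" "G \<in> H"
  shows "ip_norm ip (\<lambda>z. F z + G z) \<le> ip_norm ip F + ip_norm ip G"
proof -
  have "Re (ip (\<lambda>z. F z + G z) (\<lambda>z. F z + G z)) \<le> (ip_norm ip F + ip_norm ip G)\<^sup>2"
    using Re_ip_expand[OF assms, of 1] Re_ip_le[OF assms] ip_self_nonneg assms
    by (simp add: power2_sum ip_norm_def)
  then show ?thesis
    using ip_self_nonneg assms by (simp add: real_le_lsqrt ip_norm_def)
qed

lemma ip_norm_minus_commute:
  assumes "F \<in> H" "G \<in> H"
  shows "ip_norm ip (\<lambda>z. F z - G z) = ip_norm ip (\<lambda>z. G z - F z)"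
  using Re_ip_expand[OF zero_mem diff_mem[OF assms], of "- 1"] zero_mem diff_mem[OF assms]
  by (simp add: ip_norm_def)

sublocale Metric_space H "ip_dist H ip"
proof
  show "0 \<le> ip_dist H ip F G" for F G
    using ip_self_nonneg diff_mem by (simp add: ip_dist_def ip_norm_def)
  show "ip_dist H ip F G = ip_dist H ip G F" for F G
    using ip_norm_minus_commute[of F G] by (auto simp: ip_dist_def)
  show "ip_dist H ip F G = 0 \<longleftrightarrow> F = G" if FG: "F \<in> H" "G \<in> H" for F G
  proof
    assume "ip_dist H ip F G = 0"
    then have "Re (ip (\<lambda>z. F z - G z) (\<lambda>z. F z - G z)) = 0"
      using FG by (simp add: ip_dist_def ip_norm_def)
    then have "(\<lambda>z. F z - G z) = (\<lambda>_. 0)"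
      using ip_pos[OF diff_mem[OF FG]] by fastforce
    then show "F = G" by (auto simp: fun_eq_iff)
  next
    assume "F = G"
    then show "ip_dist H ip F G = 0" using FG zero_mem by (simp add: ip_dist_def ip_norm_def)
  qed
  show "ip_dist H ip F K \<le> ip_dist H ip F G + ip_dist H ip G K"
    if "F \<in> H" "G \<in> H" "K \<in> H" for F G K
    using that ip_norm_triangle[OF diff_mem[of F G] diff_mem[of G K]] by (simp add: ip_dist_def)
qed

end

locale entire_hilbert_space = entire_inner_product_space +
  assumes complete: "Metric_space.mcomplete H (ip_dist H ip)"

text \<open>
  In \<open>H1\<close>, \<^const>\<open>remove_sings\<close> extends the quotient analytically to the zero \<open>w\<close>; at all
  other points it leaves the quotient unchanged.
\<close>

definition H1 :: "(complex \<Rightarrow> complex) set \<Rightarrow> inner_product \<Rightarrow> bool" where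
  "H1 H ip \<longleftrightarrow> (\<forall>F\<in>H. \<forall>w. w \<notin> \<real> \<and> F w = 0 \<longrightarrow>
     (let G = remove_sings (\<lambda>z. F z * (z - cnj w) / (z - w))
      in G \<in> H \<and> ip_norm ip G = ip_norm ip F))"

definition H2 :: "(complex \<Rightarrow> complex) set \<Rightarrow> inner_product \<Rightarrow> bool" where
  "H2 H ip \<longleftrightarrow> (\<forall>w. continuous_map (ip_topology H ip) euclidean (\<lambda>F. F w))"

definition H3 :: "(complex \<Rightarrow> complex) set \<Rightarrow> inner_product \<Rightarrow> bool" where
  "H3 H ip \<longleftrightarrow> (\<forall>F\<in>H.
     (let G = (\<lambda>z. cnj (F (cnj z))) in G \<in> H \<and> ip_norm ip G = ip_norm ip F))"

definition de_branges_space :: "(complex \<Rightarrow> complex) set \<Rightarrow> inner_product \<Rightarrow> bool" where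
  "de_branges_space H ip \<longleftrightarrow>
     entire_hilbert_space H ip \<and> H \<noteq> {\<lambda>_. 0} \<and> H1 H ip \<and> H2 H ip \<and> H3 H ip"


section \<open>Discrete measures and the associated sequence spaces\<close>

definition msupport :: "'a::topological_space measure \<Rightarrow> 'a set" where
  "msupport M = {x. \<forall>U. open U \<and> x \<in> U \<longrightarrow> emeasure M U > 0}"

text \<open>
  That the complement of the support is a null set need not be required, since the real line is
  second countable (see \<open>msupport_compl_null\<close> below).
\<close>

definition discrete_measures :: "real measure set" where
  "discrete_measures = {\<mu>. sets \<mu> = sets borel \<and> infinite (msupport \<mu>) \<and>
     (\<forall>x. \<not> x islimpt msupport \<mu>) \<and>
     (\<forall>x\<in>msupport \<mu>. 0 < emeasure \<mu> {x} \<and> emeasure \<mu> {x} < \<infinity>)}"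

lemma msupport_compl_null:
  fixes M :: "'a::second_countable_topology measure"
  assumes "sets M = sets borel"
  shows "emeasure M (- msupport M) = 0"
proof -
  let ?C = "{U. open U \<and> emeasure M U = 0}"
  have eq: "- msupport M = \<Union> ?C"
    by (auto simp: msupport_def)
  obtain D where D: "D \<subseteq> ?C" "countable D" "\<Union> D = \<Union> ?C"
    using Lindelof[of ?C] by auto
  have "(\<Union>U\<in>D. U) \<in> null_sets M"
    using D assms by (intro null_sets_UN') (auto simp: null_sets_def)
  then show ?thesis using eq D by (simp add: null_setsD1)
qed

definition l2_seqs :: "real measure \<Rightarrow> (nat \<Rightarrow> real) \<Rightarrow> (nat \<Rightarrow> complex) set" where
  "l2_seqs \<mu> t = {v. summable (\<lambda>n. measure \<mu> {t n} * (cmod (v n))\<^sup>2)}"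

definition isom_isomorphic_l2 ::
  "(complex \<Rightarrow> complex) set \<Rightarrow> inner_product \<Rightarrow> real measure \<Rightarrow> (nat \<Rightarrow> real) \<Rightarrow> bool" where
  "isom_isomorphic_l2 H ip \<mu> t \<longleftrightarrow>
     (\<forall>F\<in>H. (\<lambda>n. measure \<mu> {t n} * (cmod (F (complex_of_real (t n))))\<^sup>2) sums (ip_norm ip F)\<^sup>2) \<and>
     bij_betw (\<lambda>F n. F (complex_of_real (t n))) H (l2_seqs \<mu> t)"

end

theory Submission
  imports Defs "HOL-Library.Function_Algebras"
begin

text \<open>
  Let \<open>F0 \<in> H\<close> interpolate \<open>(1, 0, 0, \<dots>)\<close> and put \<open>G z = (z - t 0) * F0 z\<close>. By \<open>H1\<close> and \<open>H3\<close>,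
  \<open>G\<close> is real, vanishes at every \<open>t n\<close> and has no non-real zeros. For a linear functional \<open>L\<close> on
  sequences, \<open>H' = {F + L (F (t n))\<^sub>n * G | F \<in> H}\<close> has the same samples as \<open>H\<close>.
  By \<open>H1\<close>, for non-real \<open>w\<close> the function \<open>(F - F w / G w * G) / (z - w)\<close> lies in \<open>H\<close>, and its
  sample sequence is in the domain \<open>D\<close> of multiplication by \<open>t\<close> on \<open>\<ell>\<^sup>2\<close>. Hence
  \<open>H'\<close> inherits \<open>H1\<close> as soon as \<open>L\<close> vanishes on \<open>D\<close>, and \<open>H3\<close> if \<open>L\<close> is moreover real. Since \<open>t\<close> is
  unbounded, \<open>D\<close> is a proper subspace, so \<open>L\<close> can be chosen nonzero on \<open>\<ell>\<^sup>2\<close>; as \<open>D\<close> contains the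
  finitely supported sequences, it is dense, which gives both the density of \<open>H \<inter> H'\<close>
  and the discontinuity of \<open>L\<close>, hence of point evaluation.
\<close>

section \<open>Linear functionals vanishing on a subspace\<close>

text \<open>A basis of \<open>D\<close> stays independent when \<open>v0\<close> is added, so the
  values 0 on the basis and 1 at \<open>v0\<close> extend linearly. The functional is purely
  algebraic, so it can be nonzero even when \<open>D\<close> is dense in a larger space.\<close>

lemma ex_separating_functional:
  fixes D :: "('i \<Rightarrow> 'k::field) set"
  assumes zero: "(\<lambda>_. 0) \<in> D"
    and add: "\<And>u v. u \<in> D \<Longrightarrow> v \<in> D \<Longrightarrow> (\<lambda>i. u i + v i) \<in> D"
    and scale: "\<And>c v. v \<in> D \<Longrightarrow> (\<lambda>i. c * v i) \<in> D"
    and v0: "v0 \<notin> D"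
  obtains L :: "('i \<Rightarrow> 'k) \<Rightarrow> 'k"
  where "\<And>u v. L (\<lambda>i. u i + v i) = L u + L v" and "\<And>c v. L (\<lambda>i. c * v i) = c * L v"
    and "\<And>v. v \<in> D \<Longrightarrow> L v = 0" and "L v0 = 1"
proof -
  \<comment> \<open>Pointwise scaling gets a name so that the functions into an arbitrary field form
    an instance of \<open>vector_space\<close>.\<close>
  define sc :: "'k \<Rightarrow> ('i \<Rightarrow> 'k) \<Rightarrow> 'i \<Rightarrow> 'k" where "sc = (\<lambda>c v i. c * v i)"
  interpret V: vector_space sc
    by standard (auto simp: sc_def fun_eq_iff algebra_simps)
  interpret K: vector_space "(*) :: 'k \<Rightarrow> 'k \<Rightarrow> 'k"
    by standard (auto simp: algebra_simps)
  interpret VK: vector_space_pair sc "(*) :: 'k \<Rightarrow> 'k \<Rightarrow> 'k" ..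
  have sub: "V.subspace D"
    unfolding V.subspace_def using zero add scale
    by (auto simp: sc_def plus_fun_def zero_fun_def)
  obtain B where B: "B \<subseteq> D" "V.independent B" "D \<subseteq> V.span B"
    using V.maximal_independent_subset[of D] by blast
  have span: "V.span B = D"
    using B sub V.span_minimal by blast
  have "V.independent (insert v0 B)"
    using B v0 span V.independent_insertI by blast
  from VK.linear_independent_extend[OF this, of "\<lambda>x. if x = v0 then 1 else 0"]
  obtain g where g: "Vector_Spaces.linear sc (*) g"
    and gB: "\<And>x. x \<in> insert v0 B \<Longrightarrow> g x = (if x = v0 then 1 else 0)"
    by blast
  interpret g: Vector_Spaces.linear sc "(*)" g by (fact g)
  show thesis
  proof (rule that[of g])
    show "g (\<lambda>i. u i + v i) = g u + g v" for u v
      using g.add[of u v] by (simp add: plus_fun_def)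
    show "g (\<lambda>i. c * v i) = c * g v" for c v
      using g.scale[of c v] by (simp add: sc_def)
    show "g v = 0" if "v \<in> D" for v
    proof (rule VK.linear_eq_0_on_span[OF g])
      show "g x = 0" if "x \<in> B" for x
        using gB[of x] that B(1) v0 by auto
      show "v \<in> V.span B" using that span by simp
    qed
    show "g v0 = 1" using gB by simp
  qed
qed

lemma ex_real_separating_functional:
  fixes D :: "('i \<Rightarrow> complex) set"
  assumes zero: "(\<lambda>_. 0) \<in> D"
    and add: "\<And>u v. u \<in> D \<Longrightarrow> v \<in> D \<Longrightarrow> (\<lambda>i. u i + v i) \<in> D"
    and scale: "\<And>c v. v \<in> D \<Longrightarrow> (\<lambda>i. c * v i) \<in> D"
    and cnj: "\<And>v. v \<in> D \<Longrightarrow> (\<lambda>i. cnj (v i)) \<in> D"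
    and v0: "(\<lambda>i. complex_of_real (v0 i)) \<notin> D"
  obtains L :: "('i \<Rightarrow> complex) \<Rightarrow> complex"
  where "\<And>u v. L (\<lambda>i. u i + v i) = L u + L v" and "\<And>c v. L (\<lambda>i. c * v i) = c * L v"
    and "\<And>v. L (\<lambda>i. cnj (v i)) = cnj (L v)"
    and "\<And>v. v \<in> D \<Longrightarrow> L v = 0" and "L (\<lambda>i. complex_of_real (v0 i)) = 1"
proof -
  obtain M :: "('i \<Rightarrow> complex) \<Rightarrow> complex"
    where M: "\<And>u v. M (\<lambda>i. u i + v i) = M u + M v" "\<And>c v. M (\<lambda>i. c * v i) = c * M v"
      "\<And>v. v \<in> D \<Longrightarrow> M v = 0" "M (\<lambda>i. complex_of_real (v0 i)) = 1"
    by (rule ex_separating_functional[OF zero add scale v0]) (assumption+, rule that)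
  \<comment> \<open>Averaging \<open>M\<close> with its conjugate makes it real. The zeros on
    \<open>D\<close> survive because \<open>D\<close> is closed under conjugation, the value 1
    because \<open>v0\<close> is real.\<close>
  define L where "L v = (M v + cnj (M (\<lambda>i. cnj (v i)))) / 2" for v
  show thesis
  proof (rule that[of L])
    show "L (\<lambda>i. u i + v i) = L u + L v" for u v
      by (simp add: L_def M(1) add_divide_distrib)
    show "L (\<lambda>i. c * v i) = c * L v" for c v
      by (simp add: L_def M(2) ring_distribs)
    show "L (\<lambda>i. cnj (v i)) = cnj (L v)" for v
      by (simp add: L_def add.commute)
    show "L v = 0" if "v \<in> D" for v
      using M(3)[OF that] M(3)[OF cnj[OF that]] by (simp add: L_def)
    show "L (\<lambda>i. complex_of_real (v0 i)) = 1"
      by (simp add: L_def M(4))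
  qed
qed

section \<open>Weighted sequence spaces\<close>

text \<open>A compact interval contains only finitely many nodes, and \<open>t\<close> is injective.
  In other words, \<open>\<bar>t n\<bar>\<close> tends to infinity.\<close>

lemma finite_abs_le_if_no_islimpt:
  fixes t :: "nat \<Rightarrow> real"
  assumes "inj t" and "\<And>x. \<not> x islimpt range t"
  shows "finite {n. \<bar>t n\<bar> \<le> R}"
proof -
  have "finite ({-R..R} \<inter> range t)"
    by (rule finite_not_islimpt_in_compact) (use assms in auto)
  then have "finite (t -` ({-R..R} \<inter> range t))"
    using assms(1) by (rule finite_vimageI)
  moreover have "{n. \<bar>t n\<bar> \<le> R} \<subseteq> t -` ({-R..R} \<inter> range t)"
    by auto
  ultimately show ?thesis by (rule finite_subset[rotated])
qed

text \<open>Supported on a sparse set of nodes, \<open>v\<close> can decay fast enough to be square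
  summable and still too slowly to absorb the growth of \<open>t\<close>.\<close>

lemma ex_l2_not_in_multiplication_domain:
  fixes m t :: "nat \<Rightarrow> real"
  assumes m: "\<And>n. m n > 0" and t: "\<And>R. finite {n. \<bar>t n\<bar> \<le> R}"
  obtains v :: "nat \<Rightarrow> real"
  where "summable (\<lambda>n. m n * (v n)\<^sup>2)" and "\<not> summable (\<lambda>n. m n * (t n * v n)\<^sup>2)"
proof -
  have ex: "\<exists>n'>n. \<bar>t n'\<bar> \<ge> R" for n R
  proof -
    have "finite ({n. \<bar>t n\<bar> \<le> R} \<union> {..n})" using t by simp
    then obtain n' where "n' \<notin> {n. \<bar>t n\<bar> \<le> R} \<union> {..n}"
      using ex_new_if_finite infinite_UNIV_nat by blast
    then show ?thesis by (intro exI[of _ n']) auto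
  qed
  \<comment> \<open>Strict growth of \<open>r\<close> lets \<open>summable_mono_reindex\<close> pass
    between the subsequence and the whole sequence.\<close>
  obtain r where r: "\<And>k. \<bar>t (r k)\<bar> \<ge> 2 ^ k \<and> r k < r (Suc k)"
    using dependent_nat_choice[of "\<lambda>k n. \<bar>t n\<bar> \<ge> 2 ^ k" "\<lambda>k n n'. n < n'"] ex by metis
  then have mono: "strict_mono r" by (simp add: strict_mono_Suc_iff)
  then have inj: "inj r" by (rule strict_mono_imp_inj_on)
  \<comment> \<open>Dividing by \<open>sqrt (m n)\<close> cancels the weight, so the term at
    \<open>r k\<close> is \<open>(1/4) ^ k\<close>; the factor \<open>(t (r k))\<^sup>2\<close>,
    which is at least \<open>4 ^ k\<close>, lifts it to at least 1.\<close>
  define v where "v n = (if n \<in> range r then (1/2) ^ inv r n / sqrt (m n) else 0)" for n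
  have v: "m (r k) * (v (r k))\<^sup>2 = (1/4) ^ k" for k
  proof -
    have "(v (r k))\<^sup>2 = ((1/2) ^ k)\<^sup>2 / m (r k)"
      using m[of "r k"] inj by (simp add: v_def power_divide power_mult_distrib)
    also have "((1/2) ^ k)\<^sup>2 = (1/4 :: real) ^ k"
      by (simp add: power2_eq_square flip: power_mult_distrib)
    finally show ?thesis using m[of "r k"] by simp
  qed
  show thesis
  proof (rule that[of v])
    have "summable (\<lambda>k. m (r k) * (v (r k))\<^sup>2)"
      unfolding v by (simp add: summable_geometric)
    then show "summable (\<lambda>n. m n * (v n)\<^sup>2)"
      using summable_mono_reindex[OF mono, of "\<lambda>n. m n * (v n)\<^sup>2"] by (simp add: v_def)
    show "\<not> summable (\<lambda>n. m n * (t n * v n)\<^sup>2)"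
    proof
      assume "summable (\<lambda>n. m n * (t n * v n)\<^sup>2)"
      then have "summable (\<lambda>k. m (r k) * (t (r k) * v (r k))\<^sup>2)"
        using summable_mono_reindex[OF mono, of "\<lambda>n. m n * (t n * v n)\<^sup>2"] by (simp add: v_def)
      then have "(\<lambda>k. m (r k) * (t (r k) * v (r k))\<^sup>2) \<longlonglongrightarrow> 0"
        by (rule summable_LIMSEQ_zero)
      moreover have "m (r k) * (t (r k) * v (r k))\<^sup>2 \<ge> 1" for k
      proof -
        have "(2 ^ k)\<^sup>2 \<le> \<bar>t (r k)\<bar>\<^sup>2"
          using r[of k] by (intro power_mono) auto
        then have "4 ^ k \<le> (t (r k))\<^sup>2"
          by (simp add: power2_eq_square flip: power_mult_distrib)
        then have "4 ^ k * (1/4) ^ k \<le> (t (r k))\<^sup>2 * ((1/4) ^ k :: real)"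
          by (intro mult_right_mono) auto
        also have "4 ^ k * (1/4) ^ k = (1::real)" by (simp flip: power_mult_distrib)
        also have "(t (r k))\<^sup>2 * (1/4) ^ k = m (r k) * (t (r k) * v (r k))\<^sup>2"
          by (simp add: power_mult_distrib flip: v)
        finally show ?thesis .
      qed
      ultimately have "(1::real) \<le> 0"
        by (intro LIMSEQ_le_const[of _ 0 1]) auto
      then show False by simp
    qed
  qed
qed

lemma l2_seqs_dominated:
  assumes "v \<in> l2_seqs \<mu> t" and "\<And>n. cmod (u n) \<le> C * cmod (v n)"
  shows "u \<in> l2_seqs \<mu> t"
proof -
  have "summable (\<lambda>n. measure \<mu> {t n} * (cmod (u n))\<^sup>2)"
  proof (rule summable_comparison_test')
    show "summable (\<lambda>n. C\<^sup>2 * (measure \<mu> {t n} * (cmod (v n))\<^sup>2))"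
      using assms(1) by (simp add: l2_seqs_def summable_mult)
    show "norm (measure \<mu> {t n} * (cmod (u n))\<^sup>2) \<le> C\<^sup>2 * (measure \<mu> {t n} * (cmod (v n))\<^sup>2)" for n
    proof -
      have "(cmod (u n))\<^sup>2 \<le> (C * cmod (v n))\<^sup>2"
        using assms(2) by (intro power_mono) auto
      then have "measure \<mu> {t n} * (cmod (u n))\<^sup>2 \<le> measure \<mu> {t n} * (C * cmod (v n))\<^sup>2"
        by (intro mult_left_mono) auto
      then show ?thesis by (simp add: power_mult_distrib algebra_simps)
    qed
  qed
  then show ?thesis by (simp add: l2_seqs_def)
qed

lemma l2_seqs_add:
  assumes "u \<in> l2_seqs \<mu> t" and "v \<in> l2_seqs \<mu> t"
  shows "(\<lambda>n. u n + v n) \<in> l2_seqs \<mu> t"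
proof -
  have "summable (\<lambda>n. measure \<mu> {t n} * (cmod (u n + v n))\<^sup>2)"
  proof (rule summable_comparison_test')
    show "summable (\<lambda>n. 2 * (measure \<mu> {t n} * (cmod (u n))\<^sup>2 + measure \<mu> {t n} * (cmod (v n))\<^sup>2))"
      using assms by (intro summable_mult summable_add) (simp_all add: l2_seqs_def)
    show "norm (measure \<mu> {t n} * (cmod (u n + v n))\<^sup>2) \<le>
        2 * (measure \<mu> {t n} * (cmod (u n))\<^sup>2 + measure \<mu> {t n} * (cmod (v n))\<^sup>2)" for n
    proof -
      have "(cmod (u n + v n))\<^sup>2 \<le> (cmod (u n) + cmod (v n))\<^sup>2"
        by (intro power_mono norm_triangle_ineq) simp
      also have "\<dots> \<le> 2 * ((cmod (u n))\<^sup>2 + (cmod (v n))\<^sup>2)"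
        using zero_le_power2[of "cmod (u n) - cmod (v n)"] by (simp add: power2_eq_square algebra_simps)
      finally have "measure \<mu> {t n} * (cmod (u n + v n))\<^sup>2 \<le>
          measure \<mu> {t n} * (2 * ((cmod (u n))\<^sup>2 + (cmod (v n))\<^sup>2))"
        by (intro mult_left_mono) auto
      then show ?thesis by (simp add: algebra_simps)
    qed
  qed
  then show ?thesis by (simp add: l2_seqs_def)
qed

lemma l2_seqs_scale: "v \<in> l2_seqs \<mu> t \<Longrightarrow> (\<lambda>n. c * v n) \<in> l2_seqs \<mu> t"
  by (rule l2_seqs_dominated[of v _ _ _ "cmod c"]) (auto simp: norm_mult)

lemma l2_seqs_cnj: "v \<in> l2_seqs \<mu> t \<Longrightarrow> (\<lambda>n. cnj (v n)) \<in> l2_seqs \<mu> t"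
  by (simp add: l2_seqs_def)

lemma l2_seqs_finite_support: "finite {n. v n \<noteq> 0} \<Longrightarrow> v \<in> l2_seqs \<mu> t"
  unfolding l2_seqs_def by (simp, rule summable_finite[of "{n. v n \<noteq> 0}"]) auto

text \<open>The natural domain of the self-adjoint operator of multiplication by \<open>t\<close> on
  the weighted sequence space.\<close>

definition l2_mult_domain :: "real measure \<Rightarrow> (nat \<Rightarrow> real) \<Rightarrow> (nat \<Rightarrow> complex) set" where
  "l2_mult_domain \<mu> t =
     {v. v \<in> l2_seqs \<mu> t \<and> (\<lambda>n. complex_of_real (t n) * v n) \<in> l2_seqs \<mu> t}"

lemma l2_mult_domain_finite_support: "finite {n. v n \<noteq> 0} \<Longrightarrow> v \<in> l2_mult_domain \<mu> t"
  by (simp add: l2_mult_domain_def l2_seqs_finite_support)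

lemma l2_mult_domain_add:
  "u \<in> l2_mult_domain \<mu> t \<Longrightarrow> v \<in> l2_mult_domain \<mu> t \<Longrightarrow> (\<lambda>n. u n + v n) \<in> l2_mult_domain \<mu> t"
  by (simp add: l2_mult_domain_def l2_seqs_add ring_distribs)

lemma l2_mult_domain_scale: "v \<in> l2_mult_domain \<mu> t \<Longrightarrow> (\<lambda>n. c * v n) \<in> l2_mult_domain \<mu> t"
  using l2_seqs_scale[of "\<lambda>n. complex_of_real (t n) * v n" \<mu> t c]
  by (simp add: l2_mult_domain_def l2_seqs_scale mult.left_commute)

lemma l2_mult_domain_cnj: "v \<in> l2_mult_domain \<mu> t \<Longrightarrow> (\<lambda>n. cnj (v n)) \<in> l2_mult_domain \<mu> t"
  using l2_seqs_cnj[of "\<lambda>n. complex_of_real (t n) * v n" \<mu> t]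
  by (simp add: l2_mult_domain_def l2_seqs_cnj)

text \<open>The identity \<open>t u = v + w u\<close> exhibits \<open>t u\<close> as a sum of two
  square summable sequences: the resolvent takes its values in the domain.\<close>

lemma l2_mult_domain_resolvent:
  assumes "v \<in> l2_seqs \<mu> t" and "u \<in> l2_seqs \<mu> t"
    and "\<And>n. u n * (complex_of_real (t n) - w) = v n"
  shows "u \<in> l2_mult_domain \<mu> t"
proof -
  have "(\<lambda>n. complex_of_real (t n) * u n) = (\<lambda>n. v n + w * u n)"
    using assms(3) by (auto simp: fun_eq_iff algebra_simps simp flip: assms(3))
  then show ?thesis
    using assms l2_seqs_add[OF assms(1) l2_seqs_scale[OF assms(2), of w]]
    by (simp add: l2_mult_domain_def)
qed

section \<open>Transport along a linear bijection\<close>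

text \<open>Around every point \<open>f\<close> and \<open>g\<close> agree on a punctured
  neighbourhood, so \<open>f\<close> has the limit \<open>g z\<close> there. Verifying
  \<open>H1\<close> thus amounts to exhibiting an entire function that equals the quotient off
  \<open>w\<close>.\<close>

lemma remove_sings_eq_entire:
  assumes "g holomorphic_on UNIV" and "\<And>z. z \<noteq> w \<Longrightarrow> f z = g z"
  shows "remove_sings f = g"
proof
  fix z
  have "isCont g z"
    using assms(1) holomorphic_on_imp_continuous_on continuous_on_eq_continuous_at by blast
  then have "g \<midarrow>z\<rightarrow> g z" by (simp add: isCont_def)
  moreover have "\<forall>\<^sub>F x in at z. f x = g x"
    using eventually_neq_at_within[of w z UNIV]
    by (rule eventually_mono) (simp add: assms(2))
  ultimately have "f \<midarrow>z\<rightarrow> g z"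
    using tendsto_cong by blast
  then show "remove_sings f z = g z" by (rule remove_sings_eqI)
qed

lemma ip_dist_transport:
  assumes "\<And>F K. F \<in> H \<Longrightarrow> K \<in> H \<Longrightarrow> T (\<lambda>z. F z - K z) = (\<lambda>z. T F z - T K z)"
    and "\<And>F K. F \<in> H \<Longrightarrow> K \<in> H \<Longrightarrow> ip' (T F) (T K) = ip F K"
    and "\<And>F K. F \<in> H \<Longrightarrow> K \<in> H \<Longrightarrow> (\<lambda>z. F z - K z) \<in> H"
    and "F \<in> H" "K \<in> H"
  shows "ip_dist (T ` H) ip' (T F) (T K) = ip_dist H ip F K"
  using assms(2)[OF assms(3)[OF assms(4,5)] assms(3)[OF assms(4,5)]] assms(1,4,5)
  by (simp add: ip_dist_def ip_norm_def)

text \<open>Everything is pulled back to preimages in \<open>H\<close>: \<open>T\<close> is linear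
  and preserves inner products, so a Cauchy sequence comes from one in \<open>H\<close>, and
  \<open>T\<close> sends the limit there to a limit in the image.\<close>

lemma entire_hilbert_space_transport:
  assumes "entire_hilbert_space H ip"
    and hol: "\<And>F. F \<in> H \<Longrightarrow> T F holomorphic_on UNIV"
    and add: "\<And>F K. F \<in> H \<Longrightarrow> K \<in> H \<Longrightarrow> T (\<lambda>z. F z + K z) = (\<lambda>z. T F z + T K z)"
    and scale: "\<And>c F. F \<in> H \<Longrightarrow> T (\<lambda>z. c * F z) = (\<lambda>z. c * T F z)"
    and ip': "\<And>F K. F \<in> H \<Longrightarrow> K \<in> H \<Longrightarrow> ip' (T F) (T K) = ip F K"
  shows "entire_hilbert_space (T ` H) ip'"
proof -
  interpret entire_hilbert_space H ip by fact
  have zero: "T (\<lambda>_. 0) = (\<lambda>_. 0)"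
    using scale[OF zero_mem, of 0] by simp
  interpret T: entire_inner_product_space "T ` H" ip'
  proof
    show "(\<lambda>_. 0) \<in> T ` H" using zero zero_mem by (metis imageI)
    show "(\<lambda>z. X z + Y z) \<in> T ` H" if "X \<in> T ` H" "Y \<in> T ` H" for X Y
      using that add add_mem by (auto simp flip: add)
    show "(\<lambda>z. c * X z) \<in> T ` H" if "X \<in> T ` H" for X c
      using that scale_mem by (auto simp flip: scale)
    show "ip' (\<lambda>z. X z + Y z) Z = ip' X Z + ip' Y Z"
      if "X \<in> T ` H" "Y \<in> T ` H" "Z \<in> T ` H" for X Y Z
      using that by (auto simp: ip' add_mem ip_add simp flip: add)
    show "ip' (\<lambda>z. c * X z) Z = c * ip' X Z" if "X \<in> T ` H" "Z \<in> T ` H" for X Z c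
      using that by (auto simp: ip' scale_mem ip_scale simp flip: scale)
    show "ip' Y X = cnj (ip' X Y)" if "X \<in> T ` H" "Y \<in> T ` H" for X Y
      using that by (auto simp: ip' intro: ip_cnj)
    show "0 < Re (ip' X X)" if X: "X \<in> T ` H" "X \<noteq> (\<lambda>_. 0)" for X
    proof -
      obtain F where F: "F \<in> H" "X = T F" using X(1) by blast
      then have "F \<noteq> (\<lambda>_. 0)" using X(2) zero by blast
      then show ?thesis using F ip_pos by (simp add: ip')
    qed
  qed (use hol in auto)
  have dist: "ip_dist (T ` H) ip' (T F) (T K) = ip_dist H ip F K" if "F \<in> H" "K \<in> H" for F K
  proof (rule ip_dist_transport)
    show "T (\<lambda>z. F z - K z) = (\<lambda>z. T F z - T K z)" if "F \<in> H" "K \<in> H" for F K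
      using add[OF that(1) scale_mem[OF that(2)], of "-1"] scale[OF that(2), of "-1"] by simp
  qed (use that ip' diff_mem in auto)
  have "T.mcomplete"
    unfolding T.mcomplete_def
  proof (intro allI impI)
    fix \<sigma> assume \<sigma>: "T.MCauchy \<sigma>"
    then have "\<sigma> n \<in> T ` H" for n by (auto simp: T.MCauchy_def)
    then have "\<forall>n. \<exists>F\<in>H. \<sigma> n = T F" by blast
    then obtain \<tau> where \<tau>: "\<And>n. \<tau> n \<in> H" "\<And>n. \<sigma> n = T (\<tau> n)" by metis
    have "MCauchy \<tau>"
      using \<sigma> \<tau> by (auto simp: T.MCauchy_def MCauchy_def dist)
    then obtain F where "limitin mtopology \<tau> F sequentially"
      using complete by (auto simp: mcomplete_def)
    then have "limitin T.mtopology \<sigma> (T F) sequentially"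
      using \<tau> by (auto simp: limit_metric_sequentially T.limit_metric_sequentially dist)
    then show "\<exists>X. limitin T.mtopology \<sigma> X sequentially" by blast
  qed
  then show ?thesis by unfold_locales
qed

section \<open>De Branges spaces isomorphic to a weighted sequence space\<close>

abbreviation samples :: "(nat \<Rightarrow> real) \<Rightarrow> (complex \<Rightarrow> complex) \<Rightarrow> nat \<Rightarrow> complex" where
  "samples t F \<equiv> \<lambda>n. F (complex_of_real (t n))"

text \<open>Norms are determined by the moduli of the samples; this settles the norm conditions of
  \<open>H1\<close> and \<open>H3\<close> for the perturbed space.\<close>

lemma isom_isomorphic_l2_norm_eq:
  assumes "entire_inner_product_space H ip" and "isom_isomorphic_l2 H ip \<mu> t"
    and "F \<in> H" "K \<in> H" and "\<And>n. cmod (samples t F n) = cmod (samples t K n)"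
  shows "ip_norm ip F = ip_norm ip K"
proof -
  interpret entire_inner_product_space H ip by fact
  have "(\<lambda>n. measure \<mu> {t n} * (cmod (samples t X n))\<^sup>2) sums (ip_norm ip X)\<^sup>2" if "X \<in> H" for X
    using assms(2) that unfolding isom_isomorphic_l2_def by blast
  from this[OF assms(3)] this[OF assms(4)] have "(ip_norm ip F)\<^sup>2 = (ip_norm ip K)\<^sup>2"
    unfolding assms(5) by (rule sums_unique2)
  moreover have "ip_norm ip F \<ge> 0" "ip_norm ip K \<ge> 0"
    using assms(3,4) ip_self_nonneg by (auto simp: ip_norm_def)
  ultimately show ?thesis by simp
qed

locale de_branges_l2 =
  fixes \<mu> :: "real measure" and t :: "nat \<Rightarrow> real"
    and H :: "(complex \<Rightarrow> complex) set" and ip :: inner_product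
  assumes discrete: "\<mu> \<in> discrete_measures"
    and enum: "bij_betw t UNIV (msupport \<mu>)"
    and de_branges: "de_branges_space H ip"
    and isom: "isom_isomorphic_l2 H ip \<mu> t"
begin

sublocale entire_hilbert_space H ip
  using de_branges by (simp add: de_branges_space_def)

lemma inj_t: "inj t"
  using enum by (simp add: bij_betw_def)

lemma mass_pos: "measure \<mu> {t n} > 0"
proof -
  have "t n \<in> msupport \<mu>" using enum by (auto simp: bij_betw_def)
  then have "0 < emeasure \<mu> {t n}" "emeasure \<mu> {t n} < \<infinity>"
    using discrete by (auto simp: discrete_measures_def)
  then show ?thesis
    by (metis enn2real_positive_iff infinity_ennreal_def measure_def)
qed

lemma finite_abs_t_le: "finite {n. \<bar>t n\<bar> \<le> R}"
  using discrete enum inj_t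
  by (intro finite_abs_le_if_no_islimpt) (auto simp: discrete_measures_def bij_betw_def)

lemma samples_in_l2: "F \<in> H \<Longrightarrow> samples t F \<in> l2_seqs \<mu> t"
  using isom by (auto simp: isom_isomorphic_l2_def bij_betw_def)

lemma ex_interpolation:
  assumes "v \<in> l2_seqs \<mu> t"
  obtains F where "F \<in> H" and "samples t F = v"
proof -
  have "v \<in> samples t ` H"
    using assms isom by (simp add: isom_isomorphic_l2_def bij_betw_def)
  then show thesis using that by blast
qed

lemma eq_if_samples_eq:
  assumes "F \<in> H" "K \<in> H" "\<And>n. samples t F n = samples t K n"
  shows "F = K"
proof -
  have "inj_on (samples t) H" using isom by (simp add: isom_isomorphic_l2_def bij_betw_def)
  moreover have "samples t F = samples t K" using assms(3) by (rule ext)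
  ultimately show ?thesis using assms(1,2) by (simp add: inj_on_def)
qed

lemma H1_quotient:
  assumes "F \<in> H" and "w \<notin> \<real>" and "F w = 0"
  obtains K where "K \<in> H" and "\<And>z. z \<noteq> w \<Longrightarrow> K z = F z * (z - cnj w) / (z - w)"
proof -
  let ?f = "\<lambda>z. F z * (z - cnj w) / (z - w)"
  have "remove_sings ?f \<in> H"
    using de_branges assms by (auto simp: de_branges_space_def H1_def Let_def)
  moreover have "remove_sings ?f z = ?f z" if "z \<noteq> w" for z
  proof (rule remove_sings_at_analytic)
    have "F analytic_on {z}"
      using entire[OF assms(1)] by (metis analytic_on_open analytic_on_subset open_UNIV subset_UNIV)
    then show "?f analytic_on {z}"
      using that by (intro analytic_intros) auto
  qed
  ultimately show thesis by (rule that)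
qed

section \<open>The function \<open>G\<close> and its lack of non-real zeros\<close>

definition F0 :: "complex \<Rightarrow> complex" where
  "F0 = (SOME F. F \<in> H \<and> (\<forall>n. samples t F n = (if n = 0 then 1 else 0)))"

text \<open>The factor removes the only nonzero sample of \<open>F0\<close>. Sampling is injective
  on \<open>H\<close>, so \<open>G\<close>, being nonzero, lies outside \<open>H\<close>: adding
  multiples of it leaves \<open>H\<close> without changing samples.\<close>

definition G :: "complex \<Rightarrow> complex" where
  "G z = (z - complex_of_real (t 0)) * F0 z"

lemma F0: "F0 \<in> H" "samples t F0 n = (if n = 0 then 1 else 0)"
proof -
  have "(\<lambda>n::nat. if n = 0 then 1 else 0) \<in> l2_seqs \<mu> t"
    by (rule l2_seqs_finite_support) simp
  then obtain F where "F \<in> H" "samples t F = (\<lambda>n. if n = 0 then 1 else 0)"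
    by (rule ex_interpolation)
  then have "\<exists>F. F \<in> H \<and> (\<forall>n. samples t F n = (if n = 0 then 1 else 0))"
    by (auto simp: fun_eq_iff)
  then have "F0 \<in> H \<and> (\<forall>n. samples t F0 n = (if n = 0 then 1 else 0))"
    unfolding F0_def by (rule someI_ex)
  then show "F0 \<in> H" "samples t F0 n = (if n = 0 then 1 else 0)" by auto
qed

lemma G_samples [simp]: "samples t G n = 0"
  using F0(2)[of n] by (auto simp: G_def)

lemma G_holomorphic: "G holomorphic_on UNIV"
  unfolding G_def using entire[OF F0(1)] by (intro holomorphic_intros)

text \<open>By \<open>H3\<close> the conjugate reflection of \<open>F0\<close> lies in
  \<open>H\<close>; its samples are the same real numbers, so it is \<open>F0\<close>
  itself.\<close>

lemma G_cnj: "cnj (G (cnj z)) = G z"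
proof -
  have "(\<lambda>z. cnj (F0 (cnj z))) \<in> H"
    using de_branges F0(1) by (auto simp: de_branges_space_def H3_def Let_def)
  then have "(\<lambda>z. cnj (F0 (cnj z))) = F0"
    using F0 by (intro eq_if_samples_eq) auto
  then have "cnj (F0 (cnj z)) = F0 z" by metis
  then show ?thesis by (simp add: G_def)
qed

text \<open>At a non-real zero, \<open>H1\<close> would give an element of \<open>H\<close> whose
  samples are \<open>a\<close> times those of \<open>F0\<close>, hence \<open>a * F0\<close>. The
  factor \<open>(z - cnj w) / (z - w)\<close> would then be constant wherever \<open>F0\<close> is
  nonzero.\<close>

lemma F0_nonreal_nonzero:
  assumes w: "w \<notin> \<real>"
  shows "F0 w \<noteq> 0"
proof
  assume "F0 w = 0"
  then obtain K where K: "K \<in> H" "\<And>z. z \<noteq> w \<Longrightarrow> K z = F0 z * (z - cnj w) / (z - w)"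
    by (rule H1_quotient[OF F0(1) w]) (rule that)
  have ne: "complex_of_real x \<noteq> w" for x using w by auto
  let ?s = "complex_of_real (t 0)"
  define a where "a = (?s - cnj w) / (?s - w)"
  have "K = (\<lambda>z. a * F0 z)"
  proof (rule eq_if_samples_eq)
    show "samples t K n = samples t (\<lambda>z. a * F0 z) n" for n
      using F0(2)[of n] by (cases "n = 0") (auto simp: K(2)[OF ne] a_def)
  qed (use K F0 scale_mem in auto)
  have "F0 z = 0" if "z \<noteq> w" "z \<noteq> ?s" for z
  proof (rule ccontr)
    assume "F0 z \<noteq> 0"
    have "F0 z * (z - cnj w) / (z - w) = a * F0 z"
      using K(2)[OF that(1)] \<open>K = _\<close> by metis
    then have "F0 z * ((z - cnj w) / (z - w)) = F0 z * a" by (simp add: mult.commute)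
    with \<open>F0 z \<noteq> 0\<close> have "(z - cnj w) / (z - w) = a" using mult_left_cancel by blast
    then have "(z - cnj w) * (?s - w) = (?s - cnj w) * (z - w)"
      using that ne[of "t 0"] by (simp add: a_def divide_simps)
    \<comment> \<open>Injectivity of the Moebius factor, in cross-multiplied form.\<close>
    then have "(cnj w - w) * (z - ?s) = 0" by (simp add: algebra_simps)
    then show False using that w by (auto simp: Reals_cnj_iff)
  qed
  \<comment> \<open>\<open>F0\<close> would vanish on a punctured neighbourhood of
    \<open>t 0\<close>, against continuity and its value 1 at \<open>t 0\<close>.\<close>
  moreover have "\<forall>\<^sub>F z in at ?s. z \<noteq> w \<and> z \<noteq> ?s"
    by (intro eventually_conj eventually_neq_at_within)
  ultimately have "\<forall>\<^sub>F z in at ?s. F0 z = 0"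
    by (auto elim!: eventually_mono)
  then have "F0 \<midarrow>?s\<rightarrow> 0" by (rule tendsto_eventually)
  moreover have "F0 \<midarrow>?s\<rightarrow> F0 ?s"
    using entire[OF F0(1)] holomorphic_on_imp_continuous_on continuous_on_eq_continuous_at isCont_def
    by blast
  ultimately have "F0 ?s = 0" using LIM_unique by blast
  then show False using F0(2)[of 0] by simp
qed

lemma G_nonreal_nonzero: "w \<notin> \<real> \<Longrightarrow> G w \<noteq> 0"
  using F0_nonreal_nonzero[of w] by (auto simp: G_def)

text \<open>Since \<open>(z - cnj w) / (z - w) = 1 + (w - cnj w) / (z - w)\<close>,
  \<open>H1\<close> yields division by \<open>z - w\<close> for functions vanishing at
  \<open>w\<close>. As \<open>G\<close> has zero samples, the resolvent argument puts the samples of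
  the quotient into the domain.\<close>

lemma ex_difference_quotient:
  assumes F: "F \<in> H" and w: "w \<notin> \<real>"
  obtains K where "K \<in> H" and "\<And>z. z \<noteq> w \<Longrightarrow> K z * (z - w) = F z - F w / G w * G z"
    and "samples t K \<in> l2_mult_domain \<mu> t"
proof -
  have ne: "complex_of_real x \<noteq> w" for x using w by auto
  let ?s = "complex_of_real (t 0)"
  have cw: "w - cnj w \<noteq> 0" using w by (auto simp: Reals_cnj_iff)
  \<comment> \<open>The multiple of \<open>F0\<close> whose subtraction makes \<open>F\<close>
    vanish at \<open>w\<close>.\<close>
  define c where "c = F w / F0 w"
  define P where "P = (\<lambda>z. F z - c * F0 z)"
  have P: "P \<in> H" "P w = 0"
    unfolding P_def using F0_nonreal_nonzero[OF w]
    by (intro diff_mem scale_mem F F0(1), simp add: c_def)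
  obtain Q where Q: "Q \<in> H" "\<And>z. z \<noteq> w \<Longrightarrow> Q z = P z * (z - cnj w) / (z - w)"
    by (rule H1_quotient[OF P(1) w P(2)]) (rule that)
  \<comment> \<open>The first summand is \<open>P z / (z - w)\<close>; the second turns the
    subtracted \<open>c * F0\<close> into the required multiple of \<open>G\<close>, because
    \<open>(z - ?s) / (w - ?s) = 1 - (z - w) / (?s - w)\<close>.\<close>
  define K where "K = (\<lambda>z. 1 / (w - cnj w) * (Q z - P z) + c / (?s - w) * F0 z)"
  have "K \<in> H"
    unfolding K_def using P(1) Q(1) F0(1) by (intro add_mem scale_mem diff_mem)
  moreover have K: "K z * (z - w) = F z - F w / G w * G z" if "z \<noteq> w" for z
  proof -
    have "(Q z - P z) * (z - w) = P z * (w - cnj w)"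
      using that by (simp add: Q(2) field_simps)
    then have quot: "(Q z - P z) * (z - w) / (w - cnj w) = P z"
      using cw by (simp only:) simp
    have "K z * (z - w) = (Q z - P z) * (z - w) / (w - cnj w) + c / (?s - w) * F0 z * (z - w)"
      by (simp add: K_def distrib_right)
    also have "\<dots> = P z + c / (?s - w) * F0 z * (z - w)"
      by (simp only: quot)
    also have "\<dots> = F z - c * F0 z * (z - ?s) / (w - ?s)"
      using ne[of "t 0"] by (simp add: P_def field_simps)
    also have "\<dots> = F z - F w / G w * G z"
      using ne[of "t 0"] F0_nonreal_nonzero[OF w] by (simp add: c_def G_def field_simps)
    finally show ?thesis .
  qed
  moreover have "samples t K \<in> l2_mult_domain \<mu> t"
  proof (rule l2_mult_domain_resolvent)
    show "samples t K n * (complex_of_real (t n) - w) = samples t F n" for n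
      using K[OF ne] by simp
  qed (use F \<open>K \<in> H\<close> samples_in_l2 in auto)
  ultimately show thesis by (rule that)
qed

text \<open>Interpolate the truncations of the sample sequence: by the isometry, the squared
  distance to \<open>F\<close> is the tail of a convergent series.\<close>

lemma ex_finitely_sampled_approximation:
  assumes F: "F \<in> H"
  obtains K where "\<And>k. K k \<in> H" and "\<And>k::nat. samples t (K k) \<in> l2_mult_domain \<mu> t"
    and "limitin (ip_topology H ip) K F sequentially"
proof -
  define v where "v k n = (if n < k then samples t F n else 0)" for k n :: nat
  have fin: "finite {n. v k n \<noteq> 0}" for k
    by (rule finite_subset[of _ "{..<k}"]) (auto simp: v_def)
  have "\<exists>X. X \<in> H \<and> samples t X = v k" for k
    by (rule ex_interpolation[OF l2_seqs_finite_support[OF fin]]) blast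
  then obtain K where "\<forall>k. K k \<in> H \<and> samples t (K k) = v k"
    using choice[of "\<lambda>k X. X \<in> H \<and> samples t X = v k"] by blast
  then have K: "K k \<in> H" "samples t (K k) = v k" for k by auto
  let ?a = "\<lambda>n. measure \<mu> {t n} * (cmod (samples t F n))\<^sup>2"
  have sums: "(\<lambda>n. measure \<mu> {t n} * (cmod (samples t X n))\<^sup>2) sums (ip_norm ip X)\<^sup>2" if "X \<in> H" for X
    using isom that by (auto simp: isom_isomorphic_l2_def)
  have "(ip_dist H ip (K k) F)\<^sup>2 = suminf ?a - sum ?a {..<k}" for k
  proof -
    have "(\<lambda>n. if n < k then ?a n else 0) sums sum ?a {..<k}"
      using sums_If_finite_set[of "{..<k}" ?a] by simp
    from sums_diff[OF sums[OF F] this]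
    have "(\<lambda>n. measure \<mu> {t n} * (cmod (v k n - samples t F n))\<^sup>2) sums ((ip_norm ip F)\<^sup>2 - sum ?a {..<k})"
      by (rule back_subst[of "\<lambda>f. f sums _"]) (auto simp: v_def fun_eq_iff)
    moreover have "(\<lambda>n. measure \<mu> {t n} * (cmod (v k n - samples t F n))\<^sup>2) sums
        (ip_norm ip (\<lambda>z. K k z - F z))\<^sup>2"
      using sums[OF diff_mem[OF K(1)[of k] F]] K(2)[of k] by (simp add: fun_eq_iff)
    ultimately have "(ip_norm ip (\<lambda>z. K k z - F z))\<^sup>2 = (ip_norm ip F)\<^sup>2 - sum ?a {..<k}"
      using sums_unique2 by blast
    then show ?thesis
      using sums_unique[OF sums[OF F]] K(1) F by (simp add: ip_dist_def)
  qed
  moreover have "(\<lambda>k. suminf ?a - sum ?a {..<k}) \<longlonglongrightarrow> suminf ?a - suminf ?a"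
    using sums[OF F] by (intro tendsto_diff tendsto_const summable_LIMSEQ) (rule sums_summable)
  ultimately have "(\<lambda>k. (ip_dist H ip (K k) F)\<^sup>2) \<longlonglongrightarrow> 0" by simp
  then have "(\<lambda>k. sqrt ((ip_dist H ip (K k) F)\<^sup>2)) \<longlonglongrightarrow> sqrt 0" by (rule tendsto_real_sqrt)
  then have "limitin mtopology K F sequentially"
    using K F by (simp add: limitin_metric_dist_null)
  moreover have "samples t (K k) \<in> l2_mult_domain \<mu> t" for k
    using l2_mult_domain_finite_support[OF fin] K(2) by simp
  ultimately show thesis using K(1) that by blast
qed

text \<open>The sequence outside the multiplication domain is real, which permits a real
  \<open>L\<close>; \<open>F\<close> interpolates it and witnesses that \<open>L\<close> is nonzero
  on samples of \<open>H\<close>.\<close>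

lemma ex_functional:
  obtains L F where "\<And>u v. L (\<lambda>n. u n + v n) = L u + L v" and "\<And>c v. L (\<lambda>n. c * v n) = c * L v"
    and "\<And>v. L (\<lambda>n. cnj (v n)) = cnj (L v)"
    and "\<And>v. v \<in> l2_mult_domain \<mu> t \<Longrightarrow> L v = 0" and "F \<in> H" and "L (samples t F) = (1::complex)"
proof -
  obtain v :: "nat \<Rightarrow> real" where v: "summable (\<lambda>n. measure \<mu> {t n} * (v n)\<^sup>2)"
    "\<not> summable (\<lambda>n. measure \<mu> {t n} * (t n * v n)\<^sup>2)"
    by (rule ex_l2_not_in_multiplication_domain[OF mass_pos finite_abs_t_le]) (rule that)
  let ?v = "\<lambda>n. complex_of_real (v n)"
  have "?v \<in> l2_seqs \<mu> t" using v(1) by (simp add: l2_seqs_def)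
  then obtain F where F: "F \<in> H" "samples t F = ?v" by (rule ex_interpolation)
  have v_notin: "?v \<notin> l2_mult_domain \<mu> t"
    using v(2) by (simp add: l2_mult_domain_def l2_seqs_def norm_mult power_mult_distrib)
  have zero: "(\<lambda>_. 0) \<in> l2_mult_domain \<mu> t"
    by (rule l2_mult_domain_finite_support) simp
  obtain L where "\<And>u v. L (\<lambda>n. u n + v n) = L u + L v" "\<And>c v. L (\<lambda>n. c * v n) = c * L v"
    "\<And>v. L (\<lambda>n. cnj (v n)) = cnj (L v)"
    "\<And>v. v \<in> l2_mult_domain \<mu> t \<Longrightarrow> L v = 0" "L ?v = (1::complex)"
    by (rule ex_real_separating_functional[OF zero l2_mult_domain_add l2_mult_domain_scale
          l2_mult_domain_cnj v_notin]) (assumption+, rule that)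
  then show thesis using that[of L F] F by simp
qed

end

section \<open>The perturbed space\<close>

locale perturbed_de_branges_l2 = de_branges_l2 +
  fixes L :: "(nat \<Rightarrow> complex) \<Rightarrow> complex"
  assumes L_add: "L (\<lambda>n. u n + v n) = L u + L v"
    and L_scale: "L (\<lambda>n. c * v n) = c * L v"
    and L_cnj: "L (\<lambda>n. cnj (v n)) = cnj (L v)"
    and L_mult_domain: "v \<in> l2_mult_domain \<mu> t \<Longrightarrow> L v = 0"
begin

definition T :: "(complex \<Rightarrow> complex) \<Rightarrow> complex \<Rightarrow> complex" where
  "T F = (\<lambda>z. F z + L (samples t F) * G z)"

text \<open>The inner product that makes \<open>T\<close> unitary onto its image, where
  \<open>inv_into H T\<close> inverts \<open>T\<close>.\<close>

definition ip' :: inner_product where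
  "ip' X Y = ip (inv_into H T X) (inv_into H T Y)"

lemma T_add: "T (\<lambda>z. F z + K z) = (\<lambda>z. T F z + T K z)"
  by (simp add: T_def L_add algebra_simps)

lemma T_scale: "T (\<lambda>z. c * F z) = (\<lambda>z. c * T F z)"
  by (simp add: T_def L_scale algebra_simps)

lemma T_diff: "T (\<lambda>z. F z - K z) = (\<lambda>z. T F z - T K z)"
  using T_add[of F "\<lambda>z. - 1 * K z"] T_scale[of "- 1" K] by simp

lemma T_samples [simp]: "samples t (T F) n = samples t F n"
  by (simp add: T_def)

lemma inj_on_T: "inj_on T H"
proof (rule inj_onI)
  fix F K assume FK: "F \<in> H" "K \<in> H" "T F = T K"
  show "F = K"
    by (rule eq_if_samples_eq[OF FK(1,2)]) (metis FK(3) T_samples)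
qed

lemma ip'_T: "F \<in> H \<Longrightarrow> K \<in> H \<Longrightarrow> ip' (T F) (T K) = ip F K"
  by (simp add: ip'_def inj_on_T)

lemma T_eq_self: "samples t F \<in> l2_mult_domain \<mu> t \<Longrightarrow> T F = F"
  by (simp add: T_def L_mult_domain)

sublocale T: entire_hilbert_space "T ` H" ip'
proof (rule entire_hilbert_space_transport)
  show "entire_hilbert_space H ip" by unfold_locales
  show "T F holomorphic_on UNIV" if "F \<in> H" for F
    unfolding T_def using entire[OF that] G_holomorphic by (intro holomorphic_intros)
qed (auto simp: T_add T_scale ip'_T)

lemma isom_T: "isom_isomorphic_l2 (T ` H) ip' \<mu> t"
  unfolding isom_isomorphic_l2_def
proof
  have "ip_norm ip' (T F) = ip_norm ip F" if "F \<in> H" for F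
    using that by (simp add: ip_norm_def ip'_T)
  then show "\<forall>X\<in>T ` H. (\<lambda>n. measure \<mu> {t n} * (cmod (samples t X n))\<^sup>2) sums (ip_norm ip' X)\<^sup>2"
    using isom by (auto simp: isom_isomorphic_l2_def)
  \<comment> \<open>\<open>T\<close> changes no sample, so this composition is
    \<open>samples t\<close>.\<close>
  have "bij_betw (samples t \<circ> T) H (l2_seqs \<mu> t)"
    using isom by (simp add: isom_isomorphic_l2_def o_def)
  moreover have "bij_betw T H (T ` H)" using inj_on_T by (simp add: bij_betw_def)
  ultimately show "bij_betw (samples t) (T ` H) (l2_seqs \<mu> t)"
    using bij_betw_comp_iff by blast
qed

lemma T_norm_eq:
  assumes "X \<in> T ` H" "Y \<in> T ` H" "\<And>n. cmod (samples t X n) = cmod (samples t Y n)"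
  shows "ip_norm ip' X = ip_norm ip' Y"
  using isom_isomorphic_l2_norm_eq[OF T.entire_inner_product_space_axioms isom_T] assms by blast

text \<open>A zero of \<open>T F\<close> at \<open>w\<close> forces
  \<open>L (samples t F) = - (F w / G w)\<close>, so \<open>X z / (z - w)\<close> is the difference
  quotient \<open>K\<close> of \<open>F\<close>. Its samples lie in the domain, so \<open>T\<close>
  fixes \<open>K\<close>.\<close>

lemma H1_T: "H1 (T ` H) ip'"
  unfolding H1_def
proof (intro ballI allI impI)
  fix X w assume X: "X \<in> T ` H" and Xw: "w \<notin> \<real> \<and> X w = 0"
  then obtain F where F: "F \<in> H" "X = T F" by blast
  have w: "w \<notin> \<real>" using Xw by simp
  have ne: "complex_of_real x \<noteq> w" for x using w by auto
  have LF: "L (samples t F) = - (F w / G w)"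
    using Xw F G_nonreal_nonzero[OF w] by (simp add: T_def field_simps add_eq_0_iff)
  obtain K where K: "K \<in> H" "\<And>z. z \<noteq> w \<Longrightarrow> K z * (z - w) = F z - F w / G w * G z"
    "samples t K \<in> l2_mult_domain \<mu> t"
    by (rule ex_difference_quotient[OF F(1) w]) (rule that)
  \<comment> \<open>Comes from
    \<open>X z * (z - cnj w) / (z - w) = X z + (w - cnj w) * K z\<close>.\<close>
  define Y where "Y = T (\<lambda>z. F z + (w - cnj w) * K z)"
  have Y: "Y \<in> T ` H"
    unfolding Y_def using F(1) K(1) add_mem scale_mem by blast
  have Y_eq: "Y = (\<lambda>z. X z + (w - cnj w) * K z)"
    by (simp add: Y_def T_add T_scale T_eq_self[OF K(3)] F)
  have quot: "X z * (z - cnj w) / (z - w) = Y z" if "z \<noteq> w" for z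
  proof -
    have Xz: "X z = K z * (z - w)"
      using K(2)[OF that] by (simp add: F(2) T_def LF)
    have "X z * (z - cnj w) / (z - w) = K z * (z - cnj w)"
      using that by (simp add: Xz)
    also have "\<dots> = Y z"
      by (simp add: Y_eq Xz algebra_simps)
    finally show ?thesis .
  qed
  have "remove_sings (\<lambda>z. X z * (z - cnj w) / (z - w)) = Y"
    by (rule remove_sings_eq_entire[of Y w]) (use Y T.entire quot in auto)
  moreover have "ip_norm ip' Y = ip_norm ip' X"
  proof (rule T_norm_eq[OF Y X])
    fix n
    let ?s = "complex_of_real (t n)"
    \<comment> \<open>A real node is equidistant from \<open>w\<close> and
      \<open>cnj w\<close>.\<close>
    have "cmod (?s - cnj w) = cmod (?s - w)"
      using complex_mod_cnj[of "?s - w"] by simp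
    then show "cmod (samples t Y n) = cmod (samples t X n)"
      using ne[of "t n"] by (simp add: norm_mult norm_divide flip: quot[OF ne])
  qed
  ultimately show "let Y = remove_sings (\<lambda>z. X z * (z - cnj w) / (z - w))
    in Y \<in> T ` H \<and> ip_norm ip' Y = ip_norm ip' X"
    using Y by (simp add: Let_def)
qed

text \<open>\<open>L\<close> and \<open>G\<close> are real, so \<open>T\<close> commutes with
  conjugate reflection.\<close>

lemma H3_T: "H3 (T ` H) ip'"
  unfolding H3_def
proof
  fix X assume X: "X \<in> T ` H"
  then obtain F where F: "F \<in> H" "X = T F" by blast
  let ?Y = "\<lambda>z. cnj (X (cnj z))"
  have "(\<lambda>z. cnj (F (cnj z))) \<in> H"
    using de_branges F(1) by (auto simp: de_branges_space_def H3_def Let_def)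
  moreover have "?Y = T (\<lambda>z. cnj (F (cnj z)))"
    by (simp add: F(2) T_def L_cnj G_cnj)
  ultimately have Y: "?Y \<in> T ` H" by blast
  moreover have "ip_norm ip' ?Y = ip_norm ip' X"
    by (rule T_norm_eq[OF Y X]) simp
  ultimately show "let Y = ?Y in Y \<in> T ` H \<and> ip_norm ip' Y = ip_norm ip' X"
    by (simp add: Let_def)
qed

section \<open>Density and failure of \<open>H2\<close>\<close>

lemma T_dist: "F \<in> H \<Longrightarrow> K \<in> H \<Longrightarrow> ip_dist (T ` H) ip' (T F) (T K) = ip_dist H ip F K"
  by (rule ip_dist_transport) (auto simp: T_diff ip'_T diff_mem)

text \<open>\<open>T\<close> is isometric and fixes the finitely sampled approximants, so one
  sequence has the limit \<open>F\<close> in one space and \<open>T F\<close> in the other.\<close>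

lemma ex_common_approximation:
  assumes F: "F \<in> H"
  obtains K where "\<And>k::nat. K k \<in> H \<inter> T ` H" and "limitin mtopology K F sequentially"
    and "limitin T.mtopology K (T F) sequentially"
proof -
  obtain K where K: "\<And>k. K k \<in> H" "\<And>k::nat. samples t (K k) \<in> l2_mult_domain \<mu> t"
    "limitin mtopology K F sequentially"
    by (rule ex_finitely_sampled_approximation[OF F]) (rule that)
  have TK: "T (K k) = K k" for k using T_eq_self K(2) by blast
  have mem: "K k \<in> T ` H" for k using TK K(1) by (metis imageI)
  have "ip_dist (T ` H) ip' (K k) (T F) = ip_dist H ip (K k) F" for k
    using T_dist[OF K(1)[of k] F] TK by simp
  then have "limitin T.mtopology K (T F) sequentially"
    using K(3) F mem by (simp add: limitin_metric_dist_null T.limitin_metric_dist_null)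
  then show thesis using that[of K] K mem by blast
qed

lemma dense_in_H: "mtopology closure_of (H \<inter> T ` H) = H"
proof -
  have "\<exists>K. range K \<subseteq> (H \<inter> T ` H) \<inter> H \<and> limitin mtopology K F sequentially" if F: "F \<in> H" for F
    using ex_common_approximation[OF F] by (metis Int_iff image_subsetI)
  then show ?thesis unfolding closure_of_sequentially by blast
qed

lemma dense_in_T: "T.mtopology closure_of (H \<inter> T ` H) = T ` H"
proof -
  have "\<exists>K. range K \<subseteq> (H \<inter> T ` H) \<inter> T ` H \<and> limitin T.mtopology K (T F) sequentially"
    if F: "F \<in> H" for F
    using ex_common_approximation[OF F] by (metis Int_iff image_subsetI)
  then show ?thesis unfolding T.closure_of_sequentially by blast
qed

text \<open>Continuity of evaluation at \<open>\<i>\<close> in both spaces would force the two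
  limits \<open>F\<close> and \<open>T F\<close> of a common sequence to agree at
  \<open>\<i>\<close>, although they differ there by a nonzero multiple of
  \<open>G \<i>\<close>.\<close>

lemma not_H2_T:
  assumes F: "F \<in> H" and LF: "L (samples t F) \<noteq> 0"
  shows "\<not> H2 (T ` H) ip'"
proof
  assume "H2 (T ` H) ip'"
  then have T: "continuous_map T.mtopology euclidean (\<lambda>X. X \<i>)"
    by (simp add: H2_def)
  have H: "continuous_map mtopology euclidean (\<lambda>X. X \<i>)"
    using de_branges by (simp add: de_branges_space_def H2_def)
  obtain K where K: "limitin mtopology K F sequentially" "limitin T.mtopology K (T F) sequentially"
    using ex_common_approximation[OF F] by blast
  have "(\<lambda>k. K k \<i>) \<longlonglongrightarrow> F \<i>" "(\<lambda>k. K k \<i>) \<longlonglongrightarrow> T F \<i>"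
    using continuous_map_limit[OF H K(1)] continuous_map_limit[OF T K(2)] by (simp_all add: o_def)
  then have "F \<i> = T F \<i>" by (rule LIMSEQ_unique)
  then have "G \<i> = 0" using LF by (simp add: T_def)
  moreover have "\<i> \<notin> \<real>" by (simp add: complex_is_Real_iff)
  ultimately show False using G_nonreal_nonzero by blast
qed

end

theorem theorem2:
  fixes \<mu> :: "real measure" and t :: "nat \<Rightarrow> real"
    and H :: "(complex \<Rightarrow> complex) set" and ip :: inner_product
  assumes "\<mu> \<in> discrete_measures"
    and "bij_betw t UNIV (msupport \<mu>)"
    and "de_branges_space H ip"
    and "isom_isomorphic_l2 H ip \<mu> t"
  shows "\<exists>H' ip'. entire_hilbert_space H' ip' \<and>
    isom_isomorphic_l2 H' ip' \<mu> t \<and>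
    H1 H' ip' \<and> H3 H' ip' \<and> \<not> H2 H' ip' \<and>
    ip_topology H ip closure_of (H \<inter> H') = H \<and>
    ip_topology H' ip' closure_of (H \<inter> H') = H'"
proof -
  interpret de_branges_l2 \<mu> t H ip
    using assms by unfold_locales
  obtain L F where L: "\<And>u v. L (\<lambda>n. u n + v n) = L u + L v" "\<And>c v. L (\<lambda>n. c * v n) = c * L v"
    "\<And>v. L (\<lambda>n. cnj (v n)) = cnj (L v)" "\<And>v. v \<in> l2_mult_domain \<mu> t \<Longrightarrow> L v = 0"
    and F: "F \<in> H" "L (samples t F) = (1::complex)"
    by (rule ex_functional) (rule that)
  interpret perturbed_de_branges_l2 \<mu> t H ip L
    using L by unfold_locales
  have "\<not> H2 (T ` H) ip'" using not_H2_T F by simp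
  then show ?thesis
    using T.entire_hilbert_space_axioms isom_T H1_T H3_T dense_in_H dense_in_T by blast
qed

end
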